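(* Let $n\in\mathbb{N}$, let $\Omega\subseteq\mathbb{R}^n$ be an unbounded domain, and let $T\in(0,\infty)$. Let $a_{ij},b_i,c,d:\Omega_T\to\mathbb{R}$ ($i,j=1,\dots,n$), and suppose there is a constant $A_{\min}>0$ such that $$A_{\min}|\eta|^2\le \sum_{i,j=1}^n a_{ij}(x,t)\eta_i\eta_j\qquad\forall (x,t)\in\Omega_T,\ \eta\in\mathbb{R}^n .$$ Let $\phi\in L^1(\mathbb{R}^n)$ with $\phi\ge 0$ on $\mathbb{R}^n$, let $Ju(x,t)=\int_\Omega \phi(x-y)u(y,t)\,dy$, and let $P$ be the operator $$P[u]=\sum_{i,j=1}^n a_{ij}\,\partial_{x_ix_j}u+\sum_{i=1}^n b_i\,\partial_{x_i}u+c\,u+d\,Ju-\partial_t u\qquad\text{on }\Omega_T .$$ Let $\psi(x)=\phi(x)|x|^2$ for $x\in\mathbb{R}^n$. Let $u\in \mathcal{C}(\overline{\Omega}_T)\cap \mathcal{C}^{2,1}(\Omega_T)\cap L^\infty(\overline{\Omega}_T)$. Suppose that, for some non-negative constants $A,B,C,D$: (i) $P[u]\le 0$ on $\Omega_T$; (ii) $u\ge 0$ on $\partial\Omega_T$; (iii) $\sum_{i,j=1}^n a_{ij}(x,t)\eta_i\eta_j\le A(1+|x|^2)|\eta|^2$ for all $(x,t)\in\Omega_T$, $\eta\in\mathbb{R}^n$; (iv) $\sum_{i=1}^n b_i(x,t)x_i\le B(1+|x|^2)$ for all $(x,t)\in\Omega_T$; (v) $c(x,t)\le C$ for all $(x,t)\in\Omega_T$;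 (vi) $0\le d(x,t)\le D$ for all $(x,t)\in\Omega_T$; (vii) $\psi\in L^1(\mathbb{R}^n)$. Then $u\ge 0$ on $\overline{\Omega}_T$.
   Context: Notation: $\Omega_T=\Omega\times(0,T]$; $\partial\Omega_T=(\Omega\times\{0\})\cup(\partial\Omega\times(0,T))$ (the parabolic boundary, where $\partial\Omega$ is the topological boundary of $\Omega$ in $\mathbb{R}^n$); $\overline{\Omega}_T$ is the closure of $\Omega_T$, i.e. $\overline{\Omega}\times[0,T]$. $|\cdot|$ is the Euclidean norm on $\mathbb{R}^n$. $\mathcal{C}(X)$ is the set of continuous real-valued functions on $X$. $\mathcal{C}^{2,1}(\Omega_T)$ is the set of continuous $u:\Omega_T\to\mathbb{R}$ whose spatial partial derivatives up to order $2$ (including mixed ones) and first time derivative $\partial_t u$ exist and are continuous on $\Omega_T$ (at $t=T$ the time derivative is one-sided). $L^\infty(X)$ denotes the (essentially) bounded real-valued functions on $X$. No regularity of the coefficients $a_{ij},b_i,c,d$ is assumed beyond what is stated. *)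

theory Defs
  imports "HOL-Analysis.Analysis"
begin

text \<open>Points of space-time are pairs \<open>(x, t)\<close>; \<open>par_cyl \<Omega> T\<close> is \<open>\<Omega>\<^sub>T\<close> and
  \<open>par_bdry \<Omega> T\<close> is its parabolic boundary \<open>\<partial>\<Omega>\<^sub>T\<close>.\<close>

definition par_cyl :: "(real^'n) set \<Rightarrow> real \<Rightarrow> ((real^'n) \<times> real) set" where
  "par_cyl \<Omega> T = \<Omega> \<times> {0<..T}"

definition par_bdry :: "(real^'n) set \<Rightarrow> real \<Rightarrow> ((real^'n) \<times> real) set" where
  "par_bdry \<Omega> T = (\<Omega> \<times> {0}) \<union> (frontier \<Omega> \<times> {0<..<T})"

text \<open>All functions are total. For open \<open>\<Omega>\<close> the partial derivatives below, at points of
  \<open>par_cyl \<Omega> T\<close>, depend only on the values of the function on \<open>par_cyl \<Omega> T\<close>.\<close>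

definition has_dx :: "'n \<Rightarrow> ((real^'n) \<times> real \<Rightarrow> real) \<Rightarrow> (real^'n) \<times> real \<Rightarrow> bool" where
  "has_dx i u = (\<lambda>(x, t). (\<lambda>h. u (x + h *\<^sub>R axis i 1, t)) field_differentiable (at 0))"

definition dx :: "'n \<Rightarrow> ((real^'n) \<times> real \<Rightarrow> real) \<Rightarrow> (real^'n) \<times> real \<Rightarrow> real" where
  "dx i u = (\<lambda>(x, t). deriv (\<lambda>h. u (x + h *\<^sub>R axis i 1, t)) 0)"

text \<open>The derivative is taken within \<open>(0, T]\<close>, so that it is one-sided exactly at \<open>t = T\<close>.\<close>

definition has_dt :: "real \<Rightarrow> ((real^'n) \<times> real \<Rightarrow> real) \<Rightarrow> (real^'n) \<times> real \<Rightarrow> bool" where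
  "has_dt T u = (\<lambda>(x, t). (\<lambda>s. u (x, s)) differentiable (at t within {0<..T}))"

definition dt :: "real \<Rightarrow> ((real^'n) \<times> real \<Rightarrow> real) \<Rightarrow> (real^'n) \<times> real \<Rightarrow> real" where
  "dt T u = (\<lambda>(x, t). vector_derivative (\<lambda>s. u (x, s)) (at t within {0<..T}))"

definition C21 :: "(real^'n) set \<Rightarrow> real \<Rightarrow> ((real^'n) \<times> real \<Rightarrow> real) set" where
  "C21 \<Omega> T = {u.
     continuous_on (par_cyl \<Omega> T) u \<and>
     (\<forall>i. (\<forall>z\<in>par_cyl \<Omega> T. has_dx i u z) \<and> continuous_on (par_cyl \<Omega> T) (dx i u)) \<and>
     (\<forall>i j. (\<forall>z\<in>par_cyl \<Omega> T. has_dx i (dx j u) z) \<and>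
            continuous_on (par_cyl \<Omega> T) (dx i (dx j u))) \<and>
     (\<forall>z\<in>par_cyl \<Omega> T. has_dt T u z) \<and> continuous_on (par_cyl \<Omega> T) (dt T u)}"

definition Linfty :: "'a::euclidean_space set \<Rightarrow> ('a \<Rightarrow> real) set" where
  "Linfty X = {u. set_borel_measurable lebesgue X u \<and>
                  (\<exists>M. AE z in lebesgue. z \<in> X \<longrightarrow> \<bar>u z\<bar> \<le> M)}"

definition nonlocal ::
  "(real^'n) set \<Rightarrow> (real^'n \<Rightarrow> real) \<Rightarrow> ((real^'n) \<times> real \<Rightarrow> real) \<Rightarrow> (real^'n) \<times> real \<Rightarrow> real"
  where
  "nonlocal \<Omega> \<phi> u = (\<lambda>(x, t). set_lebesgue_integral lebesgue \<Omega> (\<lambda>y. \<phi> (x - y) * u (y, t)))"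

definition par_op ::
  "(real^'n) set \<Rightarrow> real \<Rightarrow> ('n \<Rightarrow> 'n \<Rightarrow> (real^'n) \<times> real \<Rightarrow> real) \<Rightarrow>
   ('n \<Rightarrow> (real^'n) \<times> real \<Rightarrow> real) \<Rightarrow> ((real^'n) \<times> real \<Rightarrow> real) \<Rightarrow>
   ((real^'n) \<times> real \<Rightarrow> real) \<Rightarrow> (real^'n \<Rightarrow> real) \<Rightarrow>
   ((real^'n) \<times> real \<Rightarrow> real) \<Rightarrow> (real^'n) \<times> real \<Rightarrow> real"
  where
  "par_op \<Omega> T a b c d \<phi> u z =
     (\<Sum>i\<in>UNIV. \<Sum>j\<in>UNIV. a i j z * dx i (dx j u) z)
     + (\<Sum>i\<in>UNIV. b i z * dx i u z)
     + c z * u z + d z * nonlocal \<Omega> \<phi> u z - dt T u z"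

end

theory Submission
  imports Defs
begin

text \<open>
  The function \<open>h (x, t) = exp (K t) (1 + |x|\<^sup>2)\<close> is a strict supersolution of the same equation once
  \<open>K\<close> is large: each term of the operator applied to \<open>h\<close>, other than the time derivative, is at most
  a constant multiple of \<open>h\<close>. For the local terms these are the growth conditions on the
  coefficients. For the nonlocal term it follows from \<open>|y|\<^sup>2 \<le> 2 |x|\<^sup>2 + 2 |x - y|\<^sup>2\<close>, which
  bounds the convolution of \<open>\<phi>\<close> with \<open>1 + |y|\<^sup>2\<close> through the mass and the second moment
  of \<open>\<phi>\<close> (\<open>quadratic_growth_convolution_lower_bound\<close>).

  Fix \<open>\<epsilon> > 0\<close> and put \<open>v = u + \<epsilon> h\<close>. As \<open>u\<close> is bounded and \<open>h\<close> grows in \<open>x\<close>, the set \<open>v \<le> 0\<close> is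
  compact. If it is nonempty it has a point \<open>(x, t)\<close> of least time
  (\<open>first_touching_time\<close>). On the parabolic boundary \<open>v > 0\<close>, so \<open>x\<close> is interior and \<open>t > 0\<close>;
  moreover \<open>v (x, t) = 0\<close> is the minimum of the slice \<open>v (\<cdot>, t)\<close>. Hence at that point the
  gradient of \<open>v\<close> vanishes, its Hessian is positive semidefinite, its time derivative is at most
  0 and its nonlocal term is nonnegative, so that \<open>P[v] \<ge> 0\<close>. But \<open>P[v] = P[u] + \<epsilon> P[h] < 0\<close>.
  The contradiction is carried out for \<open>u\<close> in \<open>par_op_pos_at_touching_point\<close>, with the derivatives of
  \<open>h\<close> moved to the other side, so that it takes the form \<open>P[u] > 0\<close>. Letting \<open>\<epsilon>\<close> tend to 0 gives \<open>u \<ge> 0\<close>.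

  That a positive semidefinite Hessian pairs nonnegatively with the diffusion matrix
  (\<open>trace_product_nonneg\<close>) requires a symmetric Hessian, because \<open>a\<close> is not assumed symmetric: two
  matrices with nonnegative quadratic forms can have antisymmetric parts whose pairing is
  negative. Regularity is given through partial derivatives only, so symmetry
  (\<open>mixed_partials_commute\<close>) and the second derivative along arbitrary lines
  (\<open>local_min_second_order\<close>) are derived from the continuity of the partial derivatives.
\<close>

section \<open>Functions with continuous partial derivatives\<close>

definition has_partial_on ::
  "(real^'n \<Rightarrow> real) \<Rightarrow> 'n \<Rightarrow> (real^'n \<Rightarrow> real) \<Rightarrow> (real^'n) set \<Rightarrow> bool" where
  "has_partial_on f i g S \<longleftrightarrow>
     (\<forall>y\<in>S. ((\<lambda>h. f (y + h *\<^sub>R axis i 1)) has_real_derivative g y) (at 0))"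

text \<open>The derivative at 0 in the definition moves to any point of a coordinate line; the mean value
  theorem is applied in this form.\<close>
lemma has_partial_on_line:
  assumes "has_partial_on f i g S" "p + h *\<^sub>R axis i 1 \<in> S"
  shows "((\<lambda>h. f (p + h *\<^sub>R axis i 1)) has_real_derivative g (p + h *\<^sub>R axis i 1)) (at h)"
proof -
  have "((\<lambda>k. f ((p + h *\<^sub>R axis i 1) + k *\<^sub>R axis i 1)) has_real_derivative
          g (p + h *\<^sub>R axis i 1)) (at 0)"
    using assms by (auto simp: has_partial_on_def)
  then have "((\<lambda>k. f (p + (k + h) *\<^sub>R axis i 1)) has_real_derivative
          g (p + h *\<^sub>R axis i 1)) (at 0)"
    by (simp add: algebra_simps)
  then show ?thesis
    using DERIV_shift[of "\<lambda>h. f (p + h *\<^sub>R axis i 1)" _ 0 h] by simp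
qed

text \<open>Changing one coordinate of the argument at a time, the mean value theorem makes an error of at
  most \<open>e |v|\<close> per coordinate. All intermediate points lie in the ball because their offsets from
  \<open>x\<close> are componentwise bounded by \<open>v\<close>.\<close>
lemma increment_bound_coordinatewise:
  fixes f :: "real^'n \<Rightarrow> real" and g :: "'n \<Rightarrow> real^'n \<Rightarrow> real"
  assumes partial: "\<And>i. has_partial_on f i (g i) S"
    and ball: "ball x \<delta> \<subseteq> S"
    and close: "\<And>i y. y \<in> ball x \<delta> \<Longrightarrow> \<bar>g i y - g i x\<bar> \<le> e"
    and v: "norm v < \<delta>"
    and "finite I"
  shows "\<bar>f (x + (\<Sum>i\<in>I. v $ i *\<^sub>R axis i 1)) - f x - (\<Sum>i\<in>I. g i x * v $ i)\<bar>
           \<le> card I * (e * norm v)"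
  using \<open>finite I\<close>
proof induction
  case empty
  then show ?case by simp
next
  case (insert k I)
  define q where "q = (\<Sum>i\<in>I. v $ i *\<^sub>R (axis i 1 :: real^'n))"
  define L where "L = (\<lambda>h. f (x + q + h *\<^sub>R axis k 1) - g k x * h)"
  have e0: "0 \<le> e" using close[of x k] v norm_ge_zero[of v] by (simp add: le_less_trans)
  have q_nth: "q $ j = (if j \<in> I then v $ j else 0)" for j
    using insert.hyps by (simp add: q_def axis_def if_distrib cong: if_cong)
  have in_ball: "x + q + h *\<^sub>R axis k 1 \<in> ball x \<delta>" if "h \<in> closed_segment 0 (v $ k)" for h
  proof -
    have "\<bar>h\<bar> \<le> \<bar>v $ k\<bar>" using that by (auto simp: closed_segment_eq_real_ivl split: if_splits)
    then have "norm (q + h *\<^sub>R axis k 1) \<le> norm v"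
      using insert.hyps by (intro norm_le_componentwise_cart) (auto simp: q_nth axis_def)
    moreover have "dist x (x + q + h *\<^sub>R axis k 1) = norm (q + h *\<^sub>R axis k 1)"
      unfolding add.assoc by (metis add_diff_cancel_left' dist_commute dist_norm)
    ultimately show ?thesis using v by simp
  qed
  have "norm (L (v $ k) - L 0) \<le> e * norm (v $ k - 0)"
  proof (rule field_differentiable_bound)
    fix h assume h: "h \<in> closed_segment 0 (v $ k)"
    have "x + q + h *\<^sub>R axis k 1 \<in> S" using in_ball[OF h] ball by auto
    from has_partial_on_line[OF partial this]
    show "(L has_field_derivative g k (x + q + h *\<^sub>R axis k 1) - g k x) (at h within closed_segment 0 (v $ k))"
      unfolding L_def by (auto intro!: derivative_eq_intros intro: has_field_derivative_at_within)
    show "norm (g k (x + q + h *\<^sub>R axis k 1) - g k x) \<le> e"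
      using close[OF in_ball[OF h]] by simp
  qed auto
  also have "\<dots> \<le> e * norm v"
    using component_le_norm_cart[of v k] e0 by (simp add: mult_left_mono)
  finally have "\<bar>L (v $ k) - L 0\<bar> \<le> e * norm v" by simp
  with insert.IH insert.hyps show ?case
    by (simp add: L_def q_def[symmetric] algebra_simps)
qed

lemma has_derivative_continuous_partials:
  fixes f :: "real^'n \<Rightarrow> real" and g :: "'n \<Rightarrow> real^'n \<Rightarrow> real"
  assumes S: "open S" "x \<in> S"
    and partial: "\<And>i. has_partial_on f i (g i) S"
    and cont: "\<And>i. continuous_on S (g i)"
  shows "(f has_derivative (\<lambda>v. \<Sum>i\<in>UNIV. g i x * v $ i)) (at x)"
  unfolding has_derivative_at_alt
proof (intro conjI allI impI)
  show "bounded_linear (\<lambda>v::real^'n. \<Sum>i\<in>UNIV. g i x * v $ i)"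
    by (intro bounded_linear_sum bounded_linear_mult_right[THEN bounded_linear_compose]
              bounded_linear_vec_nth)
next
  fix e :: real assume "0 < e"
  define e' where "e' = e / CARD('n)"
  have "0 < e'" using \<open>0 < e\<close> by (simp add: e'_def)
  have "\<forall>\<^sub>F y in nhds x. y \<in> S" using S by (rule eventually_nhds_in_open)
  moreover have "\<forall>\<^sub>F y in nhds x. \<forall>i. \<bar>g i y - g i x\<bar> < e'"
  proof (rule eventually_all_finite)
    fix i
    have "isCont (g i) x" using cont S continuous_on_eq_continuous_at by blast
    then have "(g i \<longlongrightarrow> g i x) (nhds x)" by (simp add: tendsto_nhds_iff isCont_def)
    from tendstoD[OF this \<open>0 < e'\<close>]
    show "\<forall>\<^sub>F y in nhds x. \<bar>g i y - g i x\<bar> < e'" by (simp add: dist_real_def)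
  qed
  ultimately obtain \<delta> where \<delta>: "0 < \<delta>" "\<And>y. dist y x < \<delta> \<Longrightarrow> y \<in> S \<and> (\<forall>i. \<bar>g i y - g i x\<bar> < e')"
    using eventually_conj unfolding eventually_nhds_metric by (smt (verit, best))
  show "\<exists>d>0. \<forall>y. norm (y - x) < d \<longrightarrow>
          norm (f y - f x - (\<Sum>i\<in>UNIV. g i x * (y - x) $ i)) \<le> e * norm (y - x)"
  proof (intro exI conjI allI impI)
    fix y assume y: "norm (y - x) < \<delta>"
    have "\<bar>f (x + (\<Sum>i\<in>UNIV. (y - x) $ i *\<^sub>R axis i 1)) - f x - (\<Sum>i\<in>UNIV. g i x * (y - x) $ i)\<bar>
            \<le> real CARD('n) * (e' * norm (y - x))"
      by (rule increment_bound_coordinatewise[OF partial])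
         (use \<delta> y in \<open>force simp: dist_commute intro: less_imp_le\<close>)+
    moreover have "(\<Sum>i\<in>UNIV. (y - x) $ i *\<^sub>R axis i 1) = y - x"
      using basis_expansion[of "y - x"] by (simp add: scalar_mult_eq_scaleR)
    ultimately show "norm (f y - f x - (\<Sum>i\<in>UNIV. g i x * (y - x) $ i)) \<le> e * norm (y - x)"
      by (simp add: e'_def)
  qed (use \<delta> in auto)
qed

text \<open>Applying the mean value theorem in direction \<open>i\<close> and then in direction \<open>j\<close> turns the second
  difference quotient into the value of the mixed partial derivative at a point near \<open>x\<close>. Since the
  quotient is symmetric in \<open>i\<close> and \<open>j\<close>, so is its limit.\<close>
lemma second_difference:
  fixes f :: "real^'n \<Rightarrow> real"
  assumes S: "open S" "x \<in> S"
    and i: "has_partial_on f i g S" and j: "has_partial_on g j G S"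
    and cont: "continuous_on S G" and "0 < e"
  shows "\<forall>\<^sub>F s in at_right 0.
           \<bar>(f (x + s *\<^sub>R axis i 1 + s *\<^sub>R axis j 1) - f (x + s *\<^sub>R axis i 1)
              - f (x + s *\<^sub>R axis j 1) + f x) / s\<^sup>2 - G x\<bar> < e"
proof -
  have "isCont G x" using cont S continuous_on_eq_continuous_at by blast
  then have "(G \<longlongrightarrow> G x) (nhds x)" by (simp add: tendsto_nhds_iff isCont_def)
  from tendstoD[OF this \<open>0 < e\<close>] have "\<forall>\<^sub>F y in nhds x. dist (G y) (G x) < e" .
  moreover have "\<forall>\<^sub>F y in nhds x. y \<in> S" using S by (rule eventually_nhds_in_open)
  ultimately have "\<forall>\<^sub>F y in nhds x. y \<in> S \<and> dist (G y) (G x) < e"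
    by eventually_elim auto
  then obtain \<delta> where \<delta>: "0 < \<delta>" "\<And>y. dist y x < \<delta> \<Longrightarrow> y \<in> S \<and> dist (G y) (G x) < e"
    unfolding eventually_nhds_metric by blast
  have near: "dist (x + h *\<^sub>R axis i 1 + k *\<^sub>R axis j 1) x < \<delta>"
    if "0 \<le> h" "h \<le> s" "0 \<le> k" "k \<le> s" "s < \<delta> / 2" for h k s
  proof -
    have "norm (h *\<^sub>R axis i (1::real) + k *\<^sub>R axis j 1) \<le> h + k"
      using norm_triangle_ineq[of "h *\<^sub>R axis i (1::real)" "k *\<^sub>R axis j 1"] that by simp
    then show ?thesis using that by (simp add: dist_norm add.assoc)
  qed
  show ?thesis
    unfolding eventually_at_right_field
  proof (intro exI conjI allI impI)
    show "0 < \<delta> / 2" using \<delta> by simp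
    fix s assume s: "0 < s" "s < \<delta> / 2"
    define \<Phi> where "\<Phi> = (\<lambda>h. f (x + s *\<^sub>R axis j 1 + h *\<^sub>R axis i 1) - f (x + h *\<^sub>R axis i 1))"
    have "\<exists>z>0. z < s \<and> \<Phi> s - \<Phi> 0 =
        (s - 0) * (g (x + s *\<^sub>R axis j 1 + z *\<^sub>R axis i 1) - g (x + z *\<^sub>R axis i 1))"
    proof (rule MVT2)
      fix h assume h: "0 \<le> h" "h \<le> s"
      have "x + s *\<^sub>R axis j 1 + h *\<^sub>R axis i 1 \<in> S"
        using \<delta>(2)[OF near[of h s s]] h s by (simp add: add_ac)
      moreover have "x + h *\<^sub>R axis i 1 \<in> S"
        using \<delta>(2)[OF near[of h s 0]] h s by simp
      ultimately show "(\<Phi> has_real_derivative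
          g (x + s *\<^sub>R axis j 1 + h *\<^sub>R axis i 1) - g (x + h *\<^sub>R axis i 1)) (at h)"
        unfolding \<Phi>_def by (intro DERIV_diff has_partial_on_line[OF i])
    qed (use s in auto)
    then obtain z where z: "0 < z" "z < s" and \<Phi>z: "\<Phi> s - \<Phi> 0 =
        s * (g (x + s *\<^sub>R axis j 1 + z *\<^sub>R axis i 1) - g (x + z *\<^sub>R axis i 1))" by auto
    have "\<exists>w>0. w < s \<and> g (x + z *\<^sub>R axis i 1 + s *\<^sub>R axis j 1) - g (x + z *\<^sub>R axis i 1 + 0 *\<^sub>R axis j 1) =
        (s - 0) * G (x + z *\<^sub>R axis i 1 + w *\<^sub>R axis j 1)"
    proof (rule MVT2)
      fix h assume h: "0 \<le> h" "h \<le> s"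
      show "((\<lambda>h. g (x + z *\<^sub>R axis i 1 + h *\<^sub>R axis j 1)) has_real_derivative
          G (x + z *\<^sub>R axis i 1 + h *\<^sub>R axis j 1)) (at h)"
        using \<delta>(2)[OF near[of z s h]] h s z by (intro has_partial_on_line[OF j]) auto
    qed (use s in auto)
    then obtain w where w: "0 < w" "w < s" and gw: "g (x + z *\<^sub>R axis i 1 + s *\<^sub>R axis j 1) - g (x + z *\<^sub>R axis i 1) =
        s * G (x + z *\<^sub>R axis i 1 + w *\<^sub>R axis j 1)" by auto
    have "\<Phi> s - \<Phi> 0 = s\<^sup>2 * G (x + z *\<^sub>R axis i 1 + w *\<^sub>R axis j 1)"
      using \<Phi>z gw by (simp add: add_ac power2_eq_square)
    moreover have "f (x + s *\<^sub>R axis i 1 + s *\<^sub>R axis j 1) - f (x + s *\<^sub>R axis i 1)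
              - f (x + s *\<^sub>R axis j 1) + f x = \<Phi> s - \<Phi> 0"
      by (simp add: \<Phi>_def algebra_simps)
    ultimately have "(f (x + s *\<^sub>R axis i 1 + s *\<^sub>R axis j 1) - f (x + s *\<^sub>R axis i 1)
              - f (x + s *\<^sub>R axis j 1) + f x) / s\<^sup>2 = G (x + z *\<^sub>R axis i 1 + w *\<^sub>R axis j 1)"
      using s by simp
    then show "\<bar>(f (x + s *\<^sub>R axis i 1 + s *\<^sub>R axis j 1) - f (x + s *\<^sub>R axis i 1)
              - f (x + s *\<^sub>R axis j 1) + f x) / s\<^sup>2 - G x\<bar> < e"
      using \<delta>(2)[OF near[of z s w]] s z w by (simp add: dist_real_def)
  qed
qed

lemma mixed_partials_commute:
  fixes f :: "real^'n \<Rightarrow> real"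
  assumes S: "open S" "x \<in> S"
    and "has_partial_on f i g S" "has_partial_on g j G S" "continuous_on S G"
    and "has_partial_on f j h S" "has_partial_on h i H S" "continuous_on S H"
  shows "G x = H x"
proof -
  let ?\<Delta> = "\<lambda>s. (f (x + s *\<^sub>R axis i 1 + s *\<^sub>R axis j 1) - f (x + s *\<^sub>R axis i 1)
              - f (x + s *\<^sub>R axis j 1) + f x) / s\<^sup>2"
  have "(?\<Delta> \<longlongrightarrow> G x) (at_right 0)"
    using second_difference[OF S assms(3-5)] by (intro tendstoI) (simp add: dist_real_def)
  moreover have "(?\<Delta> \<longlongrightarrow> H x) (at_right 0)"
    using second_difference[OF S assms(6-8)] by (intro tendstoI) (simp add: dist_real_def algebra_simps)
  ultimately show ?thesis
    by (intro tendsto_unique) auto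
qed

section \<open>Pairing with a positive semidefinite matrix\<close>

lemma sum_mult_delta:
  fixes F :: "'n::finite \<Rightarrow> real"
  shows "(\<Sum>j\<in>UNIV. F j * (if j = k then 1 else 0)) = F k"
  by (simp add: if_distrib cong: if_cong)

text \<open>One step of symmetric Gaussian elimination: the new form at \<open>v\<close> is the minimum of the old form
  over all vectors \<open>v + s e\<^sub>k\<close>.\<close>
lemma elimination_step_psd:
  fixes M :: "'n::finite \<Rightarrow> 'n \<Rightarrow> real"
  assumes sym: "\<And>i j. M i j = M j i"
    and psd: "\<And>v. 0 \<le> (\<Sum>i\<in>UNIV. \<Sum>j\<in>UNIV. M i j * v i * v j)"
    and pivot: "0 < M k k"
  shows "0 \<le> (\<Sum>i\<in>UNIV. \<Sum>j\<in>UNIV. (M i j - M i k * M k j / M k k) * v i * v j)"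
proof -
  define l where "l = (\<Sum>j\<in>UNIV. M k j * v j)"
  \<comment> \<open>the minimiser of the quadratic polynomial in \<open>s\<close>\<close>
  define s where "s = - (l / M k k)"
  define \<delta> where "\<delta> = (\<lambda>i. if i = k then 1 else 0 :: real)"
  let ?q = "\<Sum>i\<in>UNIV. \<Sum>j\<in>UNIV. M i j * v i * v j"
  have l': "l = (\<Sum>j\<in>UNIV. M j k * v j)" unfolding l_def by (intro sum.cong refl) (simp only: sym[of k])
  have "(\<Sum>i\<in>UNIV. \<Sum>j\<in>UNIV. M i j * (v i + s * \<delta> i) * (v j + s * \<delta> j))
      = ?q + s * (\<Sum>i\<in>UNIV. \<Sum>j\<in>UNIV. M i j * v i * \<delta> j)
           + s * (\<Sum>i\<in>UNIV. \<Sum>j\<in>UNIV. M i j * v j * \<delta> i)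
           + s\<^sup>2 * (\<Sum>i\<in>UNIV. \<Sum>j\<in>UNIV. M i j * \<delta> i * \<delta> j)"
    by (simp add: algebra_simps sum.distrib sum_distrib_left power2_eq_square)
  also have "(\<Sum>i\<in>UNIV. \<Sum>j\<in>UNIV. M i j * v i * \<delta> j) = l"
    by (simp only: \<delta>_def sum_mult_delta l')
  also have "(\<Sum>i\<in>UNIV. \<Sum>j\<in>UNIV. M i j * v j * \<delta> i) = l"
    by (subst sum.swap) (simp only: \<delta>_def sum_mult_delta l_def)
  also have "(\<Sum>i\<in>UNIV. \<Sum>j\<in>UNIV. M i j * \<delta> i * \<delta> j) = M k k"
    by (simp only: \<delta>_def sum_mult_delta)
  finally have "0 \<le> ?q + s * l + s * l + s\<^sup>2 * M k k"
    using psd[of "\<lambda>i. v i + s * \<delta> i"] by simp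
  also have "\<dots> = ?q - l * l / M k k"
    using pivot by (simp add: s_def power2_eq_square)
  also have "l * l / M k k = (\<Sum>i\<in>UNIV. \<Sum>j\<in>UNIV. M i k * M k j / M k k * v i * v j)"
    by (subst l', unfold l_def) (simp add: sum_product sum_divide_distrib mult_ac)
  also have "?q - \<dots> = (\<Sum>i\<in>UNIV. \<Sum>j\<in>UNIV. (M i j - M i k * M k j / M k k) * v i * v j)"
    by (simp add: sum_subtractf algebra_simps)
  finally show ?thesis .
qed

text \<open>Otherwise the form would be affine and not constant along the line of vectors \<open>s e\<^sub>k + e\<^sub>j\<close>,
  hence negative somewhere on it.\<close>
lemma psd_zero_diagonal:
  fixes M :: "'n::finite \<Rightarrow> 'n \<Rightarrow> real"
  assumes sym: "\<And>i j. M i j = M j i"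
    and psd: "\<And>v. 0 \<le> (\<Sum>i\<in>UNIV. \<Sum>j\<in>UNIV. M i j * v i * v j)"
    and "M k k = 0"
  shows "M k j = 0"
proof (rule ccontr)
  assume nz: "M k j \<noteq> 0"
  with assms have "j \<noteq> k" by auto
  \<comment> \<open>chosen so that the form takes the value \<open>-1\<close>\<close>
  define s where "s = - (M j j + 1) / (2 * M k j)"
  define v where "v = (\<lambda>i. if i = k then s else if i = j then 1 else 0)"
  have "(\<Sum>i\<in>UNIV. \<Sum>l\<in>UNIV. M i l * v i * v l) = (\<Sum>i\<in>{k,j}. \<Sum>l\<in>{k,j}. M i l * v i * v l)"
    by (intro sum.mono_neutral_cong_right) (auto simp: v_def intro!: sum.mono_neutral_cong_right)
  also have "\<dots> = 2 * s * M k j + M j j"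
    using \<open>j \<noteq> k\<close> \<open>M k k = 0\<close> sym[of j k] by (simp add: v_def)
  also have "\<dots> = -1" using nz by (simp add: s_def field_simps)
  finally show False using psd[of v] by simp
qed

text \<open>Elimination writes \<open>M\<close> as a sum of matrices \<open>w w\<^sup>T\<close>, and the pairing of \<open>a\<close> with \<open>w w\<^sup>T\<close> is
  the value at \<open>w\<close> of the quadratic form of \<open>a\<close>. The induction is on a set of indices outside which
  the rows of \<open>M\<close> vanish, and takes off one such matrix per index.\<close>
lemma trace_product_nonneg:
  fixes a M :: "'n::finite \<Rightarrow> 'n \<Rightarrow> real"
  assumes a: "\<And>v. 0 \<le> (\<Sum>i\<in>UNIV. \<Sum>j\<in>UNIV. a i j * v i * v j)"
    and "\<And>i j. M i j = M j i"
    and "\<And>v. 0 \<le> (\<Sum>i\<in>UNIV. \<Sum>j\<in>UNIV. M i j * v i * v j)"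
  shows "0 \<le> (\<Sum>i\<in>UNIV. \<Sum>j\<in>UNIV. a i j * M i j)"
proof -
  have "0 \<le> (\<Sum>i\<in>UNIV. \<Sum>j\<in>UNIV. a i j * M i j)"
    if "finite I" "\<And>i j. M i j = M j i"
      "\<And>v. 0 \<le> (\<Sum>i\<in>UNIV. \<Sum>j\<in>UNIV. M i j * v i * v j)"
      "\<And>i j. i \<notin> I \<Longrightarrow> M i j = 0" for I and M :: "'n \<Rightarrow> 'n \<Rightarrow> real"
    using that
  proof (induction I arbitrary: M)
    case empty
    then show ?case by simp
  next
    case (insert k I)
    note sym = insert.prems(1) and psd = insert.prems(2) and supp = insert.prems(3)
    have "M k k = (\<Sum>i\<in>UNIV. \<Sum>j\<in>UNIV. M i j * (if i = k then 1 else 0) * (if j = k then 1 else 0))"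
      by (simp only: sum_mult_delta)
    then have "0 \<le> M k k" using psd[of "\<lambda>i. if i = k then 1 else 0"] by simp
    then consider "M k k = 0" | "0 < M k k" by linarith
    then show ?case
    proof cases
      case 1
      then have "M k j = 0" for j using psd_zero_diagonal[of M, OF sym psd] by blast
      then have "M i j = 0" if "i \<notin> I" for i j using supp[of i j] that by (cases "i = k") auto
      then show ?thesis by (intro insert.IH[OF sym psd])
    next
      case 2
      define N where "N = (\<lambda>i j. M i j - M i k * M k j / M k k)"
      have "0 \<le> (\<Sum>i\<in>UNIV. \<Sum>j\<in>UNIV. a i j * N i j)"
      proof (rule insert.IH)
        show "N i j = N j i" for i j unfolding N_def by (metis sym mult.commute)
        show "0 \<le> (\<Sum>i\<in>UNIV. \<Sum>j\<in>UNIV. N i j * v i * v j)" for v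
          unfolding N_def using elimination_step_psd[of M, OF sym psd 2] .
        show "N i j = 0" if "i \<notin> I" for i j
          using that supp[of i] 2 by (cases "i = k") (auto simp: N_def)
      qed
      moreover have "0 \<le> (\<Sum>i\<in>UNIV. \<Sum>j\<in>UNIV. a i j * M i k * M j k) / M k k"
        using a[of "\<lambda>i. M i k"] 2 by simp
      moreover have "(\<Sum>i\<in>UNIV. \<Sum>j\<in>UNIV. a i j * M i j) =
          (\<Sum>i\<in>UNIV. \<Sum>j\<in>UNIV. a i j * N i j) + (\<Sum>i\<in>UNIV. \<Sum>j\<in>UNIV. a i j * M i k * M j k) / M k k"
        unfolding sum_divide_distrib sum.distrib[symmetric] N_def
        by (intro sum.cong refl) (subst sym[of k], simp add: algebra_simps)
      ultimately show ?thesis by linarith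
    qed
  qed
  from this[of UNIV M] assms show ?thesis by simp
qed

section \<open>Touching a function by a paraboloid\<close>

text \<open>The second-order condition is the one-dimensional one on the line \<open>x + h v\<close>: the chain rule
  along lines follows from total differentiability, of \<open>f\<close> for the first derivative and of its
  gradient for the second.\<close>
lemma local_min_second_order:
  fixes f :: "real^'n \<Rightarrow> real"
  assumes S: "open S" "x \<in> S"
    and g: "\<And>i. has_partial_on f i (g i) S" "\<And>i. continuous_on S (g i)"
    and H: "\<And>i j. has_partial_on (g j) i (H i j) S" "\<And>i j. continuous_on S (H i j)"
    and min: "\<And>y. y \<in> S \<Longrightarrow> f x \<le> f y"
  shows "g i x = 0" and "0 \<le> (\<Sum>i\<in>UNIV. \<Sum>j\<in>UNIV. H i j x * v $ i * v $ j)"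
proof -
  obtain r where r: "0 < r" "ball x r \<subseteq> S" using S openE by blast
  have grad: "g i x = 0" for i
  proof (rule DERIV_local_min)
    show "((\<lambda>h. f (x + h *\<^sub>R axis i 1)) has_real_derivative g i x) (at 0)"
      using g(1)[of i] S by (simp add: has_partial_on_def)
    show "\<forall>h. \<bar>0 - h\<bar> < r \<longrightarrow> f (x + 0 *\<^sub>R axis i 1) \<le> f (x + h *\<^sub>R axis i 1)"
      using r by (auto intro!: min simp: subset_eq dist_norm)
  qed (rule r)
  then show "g i x = 0" .
  define R where "R = r / (norm v + 1)"
  have R: "0 < R" using r by (simp add: R_def add_nonneg_pos)
  have inS: "x + h *\<^sub>R v \<in> S" if "\<bar>h\<bar> < R" for h
  proof -
    have "\<bar>h\<bar> * norm v \<le> \<bar>h\<bar> * (norm v + 1)" by (simp add: mult_left_mono)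
    also have "\<dots> < r" using that by (simp add: R_def pos_less_divide_eq add_nonneg_pos)
    finally show ?thesis using r by (auto simp: subset_eq dist_norm)
  qed
  have line: "((\<lambda>h. \<phi> (x + h *\<^sub>R v)) has_real_derivative (\<Sum>i\<in>UNIV. p i (x + h *\<^sub>R v) * v $ i)) (at h)"
    if "\<And>i. has_partial_on \<phi> i (p i) S" "\<And>i. continuous_on S (p i)" "\<bar>h\<bar> < R" for \<phi> p h
  proof -
    have "((\<lambda>h. x + h *\<^sub>R v) has_derivative (\<lambda>k. k *\<^sub>R v)) (at h)"
      by (auto intro!: derivative_eq_intros)
    from has_derivative_compose[OF this
        has_derivative_continuous_partials[OF S(1) inS[OF that(3)] that(1,2)]]
    show ?thesis
      unfolding has_field_derivative_def
      by (rule has_derivative_eq_rhs) (auto simp: fun_eq_iff sum_distrib_left mult_ac)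
  qed
  define L where "L = (\<lambda>h. f (x + h *\<^sub>R v))"
  define L' where "L' = (\<lambda>h. \<Sum>j\<in>UNIV. g j (x + h *\<^sub>R v) * v $ j)"
  define q where "q = (\<Sum>i\<in>UNIV. \<Sum>j\<in>UNIV. H i j x * v $ i * v $ j)"
  have d1: "(L has_real_derivative L' h) (at h)" if "\<bar>h\<bar> < R" for h
    unfolding L_def L'_def using line[OF g that] .
  have "(L' has_real_derivative (\<Sum>j\<in>UNIV. (\<Sum>i\<in>UNIV. H i j x * v $ i) * v $ j)) (at 0)"
    unfolding L'_def using line[OF H, of 0] R
    by (auto intro!: DERIV_sum DERIV_cmult_right)
  also have "(\<Sum>j\<in>UNIV. (\<Sum>i\<in>UNIV. H i j x * v $ i) * v $ j) = q"
    unfolding q_def sum_distrib_right by (rule sum.swap)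
  finally have d2: "(L' has_real_derivative q) (at 0)" .
  have "0 \<le> q"
  proof (rule ccontr)
    assume "\<not> 0 \<le> q"
    then obtain d where d: "0 < d" "\<And>h. 0 < h \<Longrightarrow> h < d \<Longrightarrow> L' h < L' 0"
      using has_real_derivative_neg_dec_right[OF d2] by auto
    have "L' 0 = 0" by (simp add: L'_def grad)
    define h0 where "h0 = min d R / 2"
    have h0: "0 < h0" "h0 < d" "h0 < R" using d R by (auto simp: h0_def)
    have "\<exists>z>0. z < h0 \<and> L h0 - L 0 = (h0 - 0) * L' z"
      using h0 by (intro MVT2 d1) auto
    then obtain z where z: "0 < z" "z < h0" "L h0 - L 0 = h0 * L' z" by auto
    have "L' z < 0" using d(2)[of z] z h0 \<open>L' 0 = 0\<close> by simp
    then have "L h0 < L 0" using z h0 mult_pos_neg[of h0 "L' z"] by simp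
    then show False using min[OF inS[of h0]] h0 by (simp add: L_def)
  qed
  then show "0 \<le> (\<Sum>i\<in>UNIV. \<Sum>j\<in>UNIV. H i j x * v $ i * v $ j)" by (simp add: q_def)
qed

text \<open>The first- and second-order conditions for \<open>f + \<kappa> |\<cdot>|\<^sup>2\<close>, whose gradient and Hessian differ from
  those of \<open>f\<close> by \<open>2 \<kappa> y\<close> and \<open>2 \<kappa>\<close> times the identity.\<close>
lemma paraboloid_touching:
  fixes f :: "real^'n \<Rightarrow> real"
  assumes S: "open S" "x \<in> S"
    and g: "\<And>i. has_partial_on f i (g i) S" "\<And>i. continuous_on S (g i)"
    and H: "\<And>i j. has_partial_on (g j) i (H i j) S" "\<And>i j. continuous_on S (H i j)"
    and min: "\<And>y. y \<in> S \<Longrightarrow> f x + \<kappa> * (norm x)\<^sup>2 \<le> f y + \<kappa> * (norm y)\<^sup>2"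
    and a: "\<And>v::real^'n. 0 \<le> (\<Sum>i\<in>UNIV. \<Sum>j\<in>UNIV. a i j * v $ i * v $ j)"
  shows "g i x = - (2 * \<kappa> * x $ i)"
    and "- (2 * \<kappa> * (\<Sum>i\<in>UNIV. a i i)) \<le> (\<Sum>i\<in>UNIV. \<Sum>j\<in>UNIV. a i j * H i j x)"
proof -
  define F where "F = (\<lambda>y. f y + \<kappa> * (norm y)\<^sup>2)"
  define G where "G = (\<lambda>i y. g i y + 2 * \<kappa> * y $ i)"
  define K where "K = (\<lambda>i j y. H i j y + 2 * \<kappa> * (if j = i then 1 else 0))"
  have norm_line: "(norm (y + h *\<^sub>R axis i 1))\<^sup>2 = (norm y)\<^sup>2 + 2 * h * y $ i + h\<^sup>2"
    for y :: "real^'n" and h i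
    unfolding power2_norm_eq_inner
    by (simp add: inner_add_left inner_add_right inner_axis inner_axis' inner_commute power2_eq_square algebra_simps)
  have FG: "has_partial_on F i (G i) S" for i
    using g(1)[of i] unfolding has_partial_on_def F_def G_def norm_line
    by (auto intro!: derivative_eq_intros)
  have GK: "has_partial_on (G j) i (K i j) S" for i j
    using H(1)[of j i] unfolding has_partial_on_def G_def K_def
    by (auto intro!: derivative_eq_intros simp: axis_def)
  have G: "continuous_on S (G i)" for i
    unfolding G_def by (intro continuous_intros g)
  have K: "continuous_on S (K i j)" for i j
    unfolding K_def by (intro continuous_intros H)
  have FminS: "F x \<le> F y" if "y \<in> S" for y using min[OF that] by (simp add: F_def)
  note so = local_min_second_order[OF S FG G GK K FminS]
  from so(1)[of i] show "g i x = - (2 * \<kappa> * x $ i)" by (simp add: G_def)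
  have "0 \<le> (\<Sum>i\<in>UNIV. \<Sum>j\<in>UNIV. a i j * K i j x)"
  proof (rule trace_product_nonneg)
    show "0 \<le> (\<Sum>i\<in>UNIV. \<Sum>j\<in>UNIV. a i j * v i * v j)" for v
      using a[of "vec_lambda v"] by simp
    show "0 \<le> (\<Sum>i\<in>UNIV. \<Sum>j\<in>UNIV. K i j x * v i * v j)" for v
      using so(2)[of "vec_lambda v"] by simp
    have "H i j x = H j i x" for i j
      using mixed_partials_commute[OF S g(1) H g(1) H] .
    then show "K i j x = K j i x" for i j by (simp add: K_def)
  qed
  also have "\<dots> = (\<Sum>i\<in>UNIV. \<Sum>j\<in>UNIV. a i j * H i j x) + 2 * \<kappa> * (\<Sum>i\<in>UNIV. a i i)"
  proof -
    have "a i j * K i j x = a i j * H i j x + 2 * \<kappa> * (a i j * (if j = i then 1 else 0))" for i j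
      by (simp add: K_def algebra_simps)
    then show ?thesis
      by (simp only: sum.distrib sum_distrib_left[symmetric] sum_mult_delta)
  qed
  finally show "- (2 * \<kappa> * (\<Sum>i\<in>UNIV. a i i)) \<le> (\<Sum>i\<in>UNIV. \<Sum>j\<in>UNIV. a i j * H i j x)" by simp
qed

section \<open>The nonlocal term\<close>

lemma integral_lebesgue_reflect_translate:
  fixes f :: "'a::euclidean_space \<Rightarrow> real"
  assumes f: "integrable lebesgue f"
  shows "integrable lebesgue (\<lambda>y. f (x - y))" and "(\<integral>y. f (x - y) \<partial>lebesgue) = (\<integral>y. f y \<partial>lebesgue)"
proof -
  have T: "(\<lambda>y::'a. x + (\<Sum>j\<in>Basis. (-1 * (y \<bullet> j)) *\<^sub>R j)) = (\<lambda>y. x - y)"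
    by (simp add: fun_eq_iff sum_negf euclidean_representation)
  have meas: "(\<lambda>y. x - y) \<in> lebesgue \<rightarrow>\<^sub>M lebesgue"
    using lebesgue_affine_measurable[of "\<lambda>_::'a. -1" x] unfolding T by simp
  have inv: "distr lebesgue lebesgue (\<lambda>y. x - y) = lebesgue"
    using lebesgue_affine_euclidean[of "\<lambda>_::'a. -1" x] unfolding T by (simp add: density_1)
  have "integrable (distr lebesgue lebesgue (\<lambda>y. x - y)) f" using f by (simp add: inv)
  then show "integrable lebesgue (\<lambda>y. f (x - y))" using integrable_distr[OF meas] by blast
  show "(\<integral>y. f (x - y) \<partial>lebesgue) = (\<integral>y. f y \<partial>lebesgue)"
    using integral_distr[OF meas, of f] f by (simp add: inv)
qed

text \<open>The factor \<open>1 + |y|\<^sup>2 \<le> 1 + 2 |x|\<^sup>2 + 2 |x - y|\<^sup>2\<close> splits into a part depending on \<open>x\<close> only and a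
  part absorbed by the second moment of \<open>\<phi>\<close>.\<close>
lemma quadratic_growth_convolution_lower_bound:
  fixes \<phi> w :: "real^'n \<Rightarrow> real"
  assumes \<phi>: "integrable lebesgue \<phi>" "\<And>z. 0 \<le> \<phi> z"
    and \<psi>: "integrable lebesgue (\<lambda>z. \<phi> z * (norm z)\<^sup>2)"
    and "0 \<le> \<kappa>" and w: "\<And>y. y \<in> \<Omega> \<Longrightarrow> - (\<kappa> * (1 + (norm y)\<^sup>2)) \<le> w y"
  shows "- (2 * \<kappa> * ((\<integral>z. \<phi> z \<partial>lebesgue) + (\<integral>z. \<phi> z * (norm z)\<^sup>2 \<partial>lebesgue)) * (1 + (norm x)\<^sup>2))
           \<le> set_lebesgue_integral lebesgue \<Omega> (\<lambda>y. \<phi> (x - y) * w y)"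
proof -
  define I J where "I = (\<integral>z. \<phi> z \<partial>lebesgue)" and "J = (\<integral>z. \<phi> z * (norm z)\<^sup>2 \<partial>lebesgue)"
  define G where "G = (\<lambda>y. \<kappa> * (1 + 2 * (norm x)\<^sup>2) * \<phi> (x - y) + 2 * \<kappa> * (\<phi> (x - y) * (norm (x - y))\<^sup>2))"
  note shift\<phi> = integral_lebesgue_reflect_translate[OF \<phi>(1), of x]
  note shift\<psi> = integral_lebesgue_reflect_translate[OF \<psi>, of x]
  have G: "integrable lebesgue G" "(\<integral>y. G y \<partial>lebesgue) = \<kappa> * (1 + 2 * (norm x)\<^sup>2) * I + 2 * \<kappa> * J"
    unfolding G_def I_def J_def using shift\<phi> shift\<psi>
    by (auto simp: Bochner_Integration.integral_add)
  have G0: "0 \<le> G y" for y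
    unfolding G_def using \<phi>(2) \<open>0 \<le> \<kappa>\<close> by (intro add_nonneg_nonneg mult_nonneg_nonneg) auto
  have pointwise: "- G y \<le> indicator \<Omega> y *\<^sub>R (\<phi> (x - y) * w y)" for y
  proof (cases "y \<in> \<Omega>")
    case True
    have "norm y \<le> norm x + norm (x - y)" using norm_triangle_ineq4[of x "x - y"] by simp
    then have "(norm y)\<^sup>2 \<le> (norm x + norm (x - y))\<^sup>2" by (simp add: power_mono)
    also have "\<dots> \<le> 2 * (norm x)\<^sup>2 + 2 * (norm (x - y))\<^sup>2"
      using sum_squares_bound[of "norm x" "norm (x - y)"] by (simp add: power2_sum)
    finally have "\<kappa> * (1 + (norm y)\<^sup>2) \<le> \<kappa> * (1 + 2 * (norm x)\<^sup>2 + 2 * (norm (x - y))\<^sup>2)"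
      using \<open>0 \<le> \<kappa>\<close> by (intro mult_left_mono) auto
    with w[OF True] have "- (\<kappa> * (1 + 2 * (norm x)\<^sup>2 + 2 * (norm (x - y))\<^sup>2)) \<le> w y" by linarith
    from mult_left_mono[OF this \<phi>(2)[of "x - y"]] show ?thesis
      using True by (simp add: G_def algebra_simps)
  qed (use G0 in simp)
  have "- (\<integral>y. G y \<partial>lebesgue) \<le> set_lebesgue_integral lebesgue \<Omega> (\<lambda>y. \<phi> (x - y) * w y)"
  proof (cases "integrable lebesgue (\<lambda>y. indicator \<Omega> y *\<^sub>R (\<phi> (x - y) * w y))")
    case True
    have "(\<integral>y. - G y \<partial>lebesgue) \<le> (\<integral>y. indicator \<Omega> y *\<^sub>R (\<phi> (x - y) * w y) \<partial>lebesgue)"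
      using G(1) True pointwise by (intro integral_mono) auto
    then show ?thesis by (simp add: set_lebesgue_integral_def)
  next
    case False
    \<comment> \<open>the integral of a non-integrable function is 0 by convention\<close>
    moreover have "0 \<le> (\<integral>y. G y \<partial>lebesgue)" using G0 by simp
    ultimately show ?thesis by (simp add: set_lebesgue_integral_def not_integrable_integral_eq)
  qed
  moreover have "\<kappa> * (1 + 2 * (norm x)\<^sup>2) * I + 2 * \<kappa> * J \<le> 2 * \<kappa> * (I + J) * (1 + (norm x)\<^sup>2)"
  proof -
    have "0 \<le> I" "0 \<le> J" unfolding I_def J_def using \<phi>(2) by auto
    then have "0 \<le> \<kappa> * I" "0 \<le> \<kappa> * J * (norm x)\<^sup>2" using \<open>0 \<le> \<kappa>\<close> by auto
    then show ?thesis by (simp add: algebra_simps)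
  qed
  ultimately show ?thesis unfolding I_def[symmetric] J_def[symmetric] G(2) by linarith
qed

section \<open>The first touching time\<close>

text \<open>Only times before \<open>t\<close> are compared, so the statement covers the one-sided time derivative at the
  final time as well.\<close>
lemma left_minimum_derivative_nonpos:
  fixes L :: "real \<Rightarrow> real"
  assumes deriv: "(L has_real_derivative D) (at t within S)"
    and "a < t" and "{a<..<t} \<subseteq> S" and min: "\<And>s. a < s \<Longrightarrow> s < t \<Longrightarrow> L t \<le> L s"
  shows "D \<le> 0"
proof -
  have "(L has_real_derivative D) (at t within {a<..<t})"
    using deriv assms(3) by (rule has_field_derivative_subset)
  then have lim: "((\<lambda>s. (L s - L t) / (s - t)) \<longlongrightarrow> D) (at t within {a<..<t})"
    by (simp add: has_field_derivative_iff)
  show ?thesis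
  proof (rule tendsto_upperbound[OF lim])
    show "\<forall>\<^sub>F s in at t within {a<..<t}. (L s - L t) / (s - t) \<le> 0"
      unfolding eventually_at_filter
      by (intro always_eventually) (auto simp: divide_nonneg_neg min)
    show "at t within {a<..<t} \<noteq> bot"
      using \<open>a < t\<close> by (simp add: trivial_limit_within islimpt_in_closure closure_greaterThanLessThan)
  qed
qed

text \<open>The point \<open>(x, t)\<close> has the least time coordinate in the compact set where \<open>v\<close> is not positive. By
  continuity in time the slice at \<open>t\<close> is still nonnegative, so \<open>v\<close> vanishes at \<open>(x, t)\<close>.\<close>
lemma first_touching_time:
  fixes v :: "'a::euclidean_space \<times> real \<Rightarrow> real"
  assumes cont: "continuous_on (closure \<Omega> \<times> {0..T}) v"
    and bdd: "bounded {z \<in> closure \<Omega> \<times> {0..T}. v z \<le> 0}"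
    and init: "\<And>y. y \<in> closure \<Omega> \<Longrightarrow> 0 < v (y, 0)"
    and z: "z \<in> closure \<Omega> \<times> {0..T}" "v z \<le> 0"
  obtains x t where "x \<in> closure \<Omega>" "0 < t" "t \<le> T" "v (x, t) = 0"
    "\<And>y. y \<in> closure \<Omega> \<Longrightarrow> 0 \<le> v (y, t)" "\<And>s. 0 \<le> s \<Longrightarrow> s < t \<Longrightarrow> 0 < v (x, s)"
proof -
  let ?K = "{z \<in> closure \<Omega> \<times> {0..T}. v z \<le> 0}"
  have "closed ?K"
    using continuous_on_closed_Collect_le[OF cont continuous_on_const, of 0]
    by (simp add: closed_Times)
  then have "compact ?K" using bdd by (simp add: compact_eq_bounded_closed)
  moreover have "?K \<noteq> {}" using z by blast
  ultimately have "\<exists>p\<in>?K. \<forall>q\<in>?K. snd p \<le> snd q"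
    by (intro continuous_attains_inf continuous_on_snd continuous_on_id)
  then obtain p where p: "p \<in> ?K" "\<And>q. q \<in> ?K \<Longrightarrow> snd p \<le> snd q" by blast
  obtain x t where [simp]: "p = (x, t)" by (cases p)
  have x: "x \<in> closure \<Omega>" "0 \<le> t" "t \<le> T" "v (x, t) \<le> 0" using p(1) by auto
  have "0 < t" using init[of x] x by (cases "t = 0") auto
  have before: "0 < v (y, s)" if "y \<in> closure \<Omega>" "0 \<le> s" "s < t" for y s
    using p(2)[of "(y, s)"] that x by (auto simp: not_le[symmetric])
  have at: "0 \<le> v (y, t)" if "y \<in> closure \<Omega>" for y
  proof (rule continuous_ge_on_closure[of "{0..<t}" "\<lambda>s. v (y, s)"])
    have "closure {0..<t} = {0..t}" using \<open>0 < t\<close> by (rule closure_atLeastLessThan)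
    then show "t \<in> closure {0..<t}" "continuous_on (closure {0..<t}) (\<lambda>s. v (y, s))"
      using that x by (auto intro!: continuous_on_compose2[OF cont] continuous_intros)
    show "0 \<le> v (y, s)" if "s \<in> {0..<t}" for s
      using before[of y s] that \<open>y \<in> closure \<Omega>\<close> by auto
  qed
  show thesis
    by (rule that[of x t]) (use x at before \<open>0 < t\<close> in \<open>auto intro: antisym\<close>)
qed

section \<open>The maximum principle\<close>

text \<open>A relatively closed set that contains almost all points of an open set contains all of them.\<close>
lemma continuous_essentially_bounded_on_open:
  fixes f :: "'a::euclidean_space \<Rightarrow> real"
  assumes "open S" "continuous_on S f" "AE z in lebesgue. z \<in> S \<longrightarrow> \<bar>f z\<bar> \<le> M" "z \<in> S"
  shows "\<bar>f z\<bar> \<le> M"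
proof -
  have "closedin (top_of_set S) (S \<inter> f -` {-M..M})"
    using assms(2) by (intro continuous_closedin_preimage) auto
  then obtain C where C: "closed C" "S \<inter> f -` {-M..M} = S \<inter> C"
    by (auto simp: closedin_closed)
  then have iff: "y \<in> C \<longleftrightarrow> \<bar>f y\<bar> \<le> M" if "y \<in> S" for y
  proof -
    have "y \<in> C \<longleftrightarrow> y \<in> S \<inter> f -` {-M..M}" using C(2) that by blast
    then show ?thesis using that by (auto simp: abs_le_iff)
  qed
  have "AE z in lebesgue. z \<in> S \<longrightarrow> z \<in> C"
    using assms(3) by eventually_elim (use iff in blast)
  from mem_closed_if_AE_lebesgue_open[OF assms(1) C(1) this assms(4)]
  show ?thesis using iff assms(4) by blast
qed

lemma C21_slices:
  fixes u :: "(real^'n) \<times> real \<Rightarrow> real"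
  assumes u: "u \<in> C21 \<Omega> T" and t: "0 < t" "t \<le> T"
  shows "has_partial_on (\<lambda>x. u (x, t)) i (\<lambda>x. dx i u (x, t)) \<Omega>"
    and "continuous_on \<Omega> (\<lambda>x. dx i u (x, t))"
    and "has_partial_on (\<lambda>x. dx j u (x, t)) i (\<lambda>x. dx i (dx j u) (x, t)) \<Omega>"
    and "continuous_on \<Omega> (\<lambda>x. dx i (dx j u) (x, t))"
    and "x \<in> \<Omega> \<Longrightarrow> ((\<lambda>s. u (x, s)) has_real_derivative dt T u (x, t)) (at t within {0<..T})"
proof -
  have mem: "(y, t) \<in> par_cyl \<Omega> T" if "y \<in> \<Omega>" for y using that t by (simp add: par_cyl_def)
  have partial: "has_partial_on (\<lambda>x. w (x, t)) i (\<lambda>x. dx i w (x, t)) \<Omega>"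
    if "\<forall>z\<in>par_cyl \<Omega> T. has_dx i w z" for w :: "(real^'n) \<times> real \<Rightarrow> real"
    unfolding has_partial_on_def
  proof
    fix y assume "y \<in> \<Omega>"
    with that mem have "has_dx i w (y, t)" by blast
    then show "((\<lambda>h. w (y + h *\<^sub>R axis i 1, t)) has_real_derivative dx i w (y, t)) (at 0)"
      by (simp add: has_dx_def dx_def DERIV_deriv_iff_field_differentiable)
  qed
  have slice: "continuous_on \<Omega> (\<lambda>x. w (x, t))"
    if "continuous_on (par_cyl \<Omega> T) w" for w :: "(real^'n) \<times> real \<Rightarrow> real"
    using that by (rule continuous_on_compose2) (auto intro!: continuous_intros mem)
  show "has_partial_on (\<lambda>x. u (x, t)) i (\<lambda>x. dx i u (x, t)) \<Omega>"
    and "continuous_on \<Omega> (\<lambda>x. dx i u (x, t))"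
    and "has_partial_on (\<lambda>x. dx j u (x, t)) i (\<lambda>x. dx i (dx j u) (x, t)) \<Omega>"
    and "continuous_on \<Omega> (\<lambda>x. dx i (dx j u) (x, t))"
    using u by (auto simp: C21_def intro!: partial slice)
  show "((\<lambda>s. u (x, s)) has_real_derivative dt T u (x, t)) (at t within {0<..T})" if "x \<in> \<Omega>"
  proof -
    have "has_dt T u (x, t)" using u mem[OF that] unfolding C21_def by blast
    then show ?thesis
      by (simp add: dt_def has_dt_def vector_derivative_works has_real_derivative_iff_has_vector_derivative)
  qed
qed

text \<open>At a point where \<open>u + \<epsilon> h\<close> touches 0 from above for the first time, with \<open>h\<close> the barrier
  \<open>exp (K t) (1 + |x|\<^sup>2)\<close>, each term of the operator applied to \<open>u\<close> is bounded below by a multiple of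
  \<open>W = \<epsilon> h (x, t)\<close>, and \<open>K\<close> outweighs the sum of the constants.\<close>
lemma par_op_pos_at_touching_point:
  fixes \<Omega> :: "(real^'n) set"
  assumes \<Omega>: "open \<Omega>" "x \<in> \<Omega>" and t: "0 < t" "t \<le> T"
    and \<phi>: "integrable lebesgue \<phi>" "\<And>z. 0 \<le> \<phi> z" "integrable lebesgue (\<lambda>z. \<phi> z * (norm z)\<^sup>2)"
    and u: "u \<in> C21 \<Omega> T"
    and ell: "\<And>\<eta>::real^'n. 0 \<le> (\<Sum>i\<in>UNIV. \<Sum>j\<in>UNIV. a i j (x, t) * \<eta> $ i * \<eta> $ j)"
    and A: "\<And>\<eta>::real^'n. (\<Sum>i\<in>UNIV. \<Sum>j\<in>UNIV. a i j (x, t) * \<eta> $ i * \<eta> $ j)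
              \<le> A * (1 + (norm x)\<^sup>2) * (norm \<eta>)\<^sup>2"
    and B: "(\<Sum>i\<in>UNIV. b i (x, t) * x $ i) \<le> B * (1 + (norm x)\<^sup>2)"
    and C: "c (x, t) \<le> C" and D: "0 \<le> d (x, t)" "d (x, t) \<le> D"
    and "0 < \<epsilon>"
    and K: "2 * real CARD('n) * A + 2 * B + C
              + 2 * D * ((\<integral>z. \<phi> z \<partial>lebesgue) + (\<integral>z. \<phi> z * (norm z)\<^sup>2 \<partial>lebesgue)) < K"
    and zero: "u (x, t) + \<epsilon> * exp (K * t) * (1 + (norm x)\<^sup>2) = 0"
    and nonneg: "\<And>y. y \<in> \<Omega> \<Longrightarrow> 0 \<le> u (y, t) + \<epsilon> * exp (K * t) * (1 + (norm y)\<^sup>2)"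
    and past: "\<And>s. 0 < s \<Longrightarrow> s < t \<Longrightarrow> 0 \<le> u (x, s) + \<epsilon> * exp (K * s) * (1 + (norm x)\<^sup>2)"
  shows "0 < par_op \<Omega> T a b c d \<phi> u (x, t)"
proof -
  define \<kappa> where "\<kappa> = \<epsilon> * exp (K * t)"
  define W where "W = \<kappa> * (1 + (norm x)\<^sup>2)"
  define I where "I = (\<integral>z. \<phi> z \<partial>lebesgue) + (\<integral>z. \<phi> z * (norm z)\<^sup>2 \<partial>lebesgue)"
  have "0 < \<kappa>" using \<open>0 < \<epsilon>\<close> by (simp add: \<kappa>_def)
  then have "0 < W" by (simp add: W_def add_pos_nonneg)
  have "0 \<le> I" unfolding I_def using \<phi>(2) by simp
  have ux: "u (x, t) = - W" using zero by (simp add: W_def \<kappa>_def)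

  have min: "u (x, t) + \<kappa> * (norm x)\<^sup>2 \<le> u (y, t) + \<kappa> * (norm y)\<^sup>2" if "y \<in> \<Omega>" for y
    using nonneg[OF that] zero by (simp add: \<kappa>_def algebra_simps)
  note touch = paraboloid_touching[OF \<Omega> C21_slices(1-4)[OF u t] min ell]

  have diag: "a i i (x, t) \<le> A * (1 + (norm x)\<^sup>2)" for i
  proof -
    have "(\<Sum>k\<in>UNIV. \<Sum>j\<in>UNIV. a k j (x, t) * axis i 1 $ k * axis i 1 $ j) = a i i (x, t)"
      using sum_mult_delta[of _ i] by (simp add: axis_def)
    then show ?thesis using A[of "axis i 1"] by simp
  qed
  have "(\<Sum>i\<in>UNIV. a i i (x, t)) \<le> (\<Sum>i\<in>(UNIV::'n set). A * (1 + (norm x)\<^sup>2))"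
    by (intro sum_mono diag)
  then have "2 * \<kappa> * (\<Sum>i\<in>UNIV. a i i (x, t)) \<le> 2 * \<kappa> * (real CARD('n) * (A * (1 + (norm x)\<^sup>2)))"
    using \<open>0 < \<kappa>\<close> by (intro mult_left_mono) auto
  then have second: "- (2 * real CARD('n) * A * W)
      \<le> (\<Sum>i\<in>UNIV. \<Sum>j\<in>UNIV. a i j (x, t) * dx i (dx j u) (x, t))"
    using touch(2) by (simp add: W_def mult_ac)

  have "(\<Sum>i\<in>UNIV. b i (x, t) * dx i u (x, t)) = - (2 * \<kappa> * (\<Sum>i\<in>UNIV. b i (x, t) * x $ i))"
    by (simp add: touch(1) sum_distrib_left sum_negf mult_ac)
  moreover have "2 * \<kappa> * (\<Sum>i\<in>UNIV. b i (x, t) * x $ i) \<le> 2 * \<kappa> * (B * (1 + (norm x)\<^sup>2))"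
    using \<open>0 < \<kappa>\<close> B by (intro mult_left_mono) auto
  ultimately have first: "- (2 * B * W) \<le> (\<Sum>i\<in>UNIV. b i (x, t) * dx i u (x, t))"
    by (simp add: W_def mult_ac)

  have zeroth: "- (C * W) \<le> c (x, t) * u (x, t)"
    using C \<open>0 < W\<close> by (simp add: ux)

  have "- (2 * I * W) \<le> nonlocal \<Omega> \<phi> u (x, t)"
  proof -
    have "- (\<kappa> * (1 + (norm y)\<^sup>2)) \<le> u (y, t)" if "y \<in> \<Omega>" for y
      using nonneg[OF that] by (simp add: \<kappa>_def)
    from quadratic_growth_convolution_lower_bound[OF \<phi> less_imp_le[OF \<open>0 < \<kappa>\<close>] this]
    show ?thesis by (simp add: nonlocal_def I_def W_def mult_ac)
  qed
  then have "d (x, t) * - (2 * I * W) \<le> d (x, t) * nonlocal \<Omega> \<phi> u (x, t)"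
    using D(1) by (rule mult_left_mono)
  moreover have "d (x, t) * (2 * I * W) \<le> D * (2 * I * W)"
    using D(2) \<open>0 \<le> I\<close> \<open>0 < W\<close> by (intro mult_right_mono) auto
  ultimately have conv: "- (2 * D * I * W) \<le> d (x, t) * nonlocal \<Omega> \<phi> u (x, t)"
    by (simp add: mult_ac)

  have "((\<lambda>s. u (x, s) + \<epsilon> * exp (K * s) * (1 + (norm x)\<^sup>2)) has_real_derivative
          dt T u (x, t) + K * W) (at t within {0<..T})"
    using C21_slices(5)[OF u t \<Omega>(2)]
    by (auto intro!: derivative_eq_intros simp: W_def \<kappa>_def)
  then have time: "dt T u (x, t) + K * W \<le> 0"
    by (rule left_minimum_derivative_nonpos[OF _ t(1)]) (use past t zero in auto)

  have "0 < (K - (2 * real CARD('n) * A + 2 * B + C + 2 * D * I)) * W"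
    using K \<open>0 < W\<close> by (simp add: I_def)
  also have "\<dots> \<le> par_op \<Omega> T a b c d \<phi> u (x, t)"
    unfolding par_op_def using second first zeroth conv time by (simp add: algebra_simps)
  finally show ?thesis .
qed

theorem proposition3p1:
  fixes \<Omega> :: "(real^'n) set"
    and T A_min A B C D :: real
    and a :: "'n \<Rightarrow> 'n \<Rightarrow> (real^'n) \<times> real \<Rightarrow> real"
    and b :: "'n \<Rightarrow> (real^'n) \<times> real \<Rightarrow> real"
    and c d u :: "(real^'n) \<times> real \<Rightarrow> real"
    and \<phi> \<psi> :: "real^'n \<Rightarrow> real"
  assumes "open \<Omega>" and "connected \<Omega>" and "\<Omega> \<noteq> {}" and "\<not> bounded \<Omega>"
    and "0 < T"
    and "0 < A_min"
    and "\<And>x t (\<eta>::real^'n). (x, t) \<in> par_cyl \<Omega> T \<Longrightarrow>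
           A_min * (norm \<eta>)\<^sup>2 \<le> (\<Sum>i\<in>UNIV. \<Sum>j\<in>UNIV. a i j (x, t) * \<eta> $ i * \<eta> $ j)"
    and "integrable lebesgue \<phi>" and "\<And>x. 0 \<le> \<phi> x"
    and "\<And>x. \<psi> x = \<phi> x * (norm x)\<^sup>2"
    and "continuous_on (closure (par_cyl \<Omega> T)) u"
    and "u \<in> C21 \<Omega> T"
    and "u \<in> Linfty (closure (par_cyl \<Omega> T))"
    and "0 \<le> A" and "0 \<le> B" and "0 \<le> C" and "0 \<le> D"
    and "\<And>z. z \<in> par_cyl \<Omega> T \<Longrightarrow> par_op \<Omega> T a b c d \<phi> u z \<le> 0"
    and "\<And>z. z \<in> par_bdry \<Omega> T \<Longrightarrow> 0 \<le> u z"
    and "\<And>x t (\<eta>::real^'n). (x, t) \<in> par_cyl \<Omega> T \<Longrightarrow>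
           (\<Sum>i\<in>UNIV. \<Sum>j\<in>UNIV. a i j (x, t) * \<eta> $ i * \<eta> $ j) \<le> A * (1 + (norm x)\<^sup>2) * (norm \<eta>)\<^sup>2"
    and "\<And>x t. (x, t) \<in> par_cyl \<Omega> T \<Longrightarrow>
           (\<Sum>i\<in>UNIV. b i (x, t) * x $ i) \<le> B * (1 + (norm x)\<^sup>2)"
    and "\<And>z. z \<in> par_cyl \<Omega> T \<Longrightarrow> c z \<le> C"
    and "\<And>z. z \<in> par_cyl \<Omega> T \<Longrightarrow> 0 \<le> d z \<and> d z \<le> D"
    and "integrable lebesgue \<psi>"
  shows "\<forall>z\<in>closure (par_cyl \<Omega> T). 0 \<le> u z"
proof -
  have cl: "closure (par_cyl \<Omega> T) = closure \<Omega> \<times> {0..T}"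
    using \<open>0 < T\<close> by (simp add: par_cyl_def closure_Times closure_greaterThanAtMost)
  note cont = assms(11)[unfolded cl]
  note P_le = assms(18) and bdry = assms(19)

  \<comment> \<open>the parabolic boundary leaves out the corners at times \<open>0\<close> and \<open>T\<close>, which are limits of it\<close>
  have lateral: "0 \<le> u (x, t)" if "x \<in> frontier \<Omega>" "0 \<le> t" "t \<le> T" for x t
  proof (rule continuous_ge_on_closure[of "{0<..<T}" "\<lambda>s. u (x, s)"])
    have "closure {0<..<T} = {0..T}" using \<open>0 < T\<close> by (rule closure_greaterThanLessThan)
    then show "t \<in> closure {0<..<T}" "continuous_on (closure {0<..<T}) (\<lambda>s. u (x, s))"
      using that by (auto simp: frontier_def intro!: continuous_on_compose2[OF cont] continuous_intros)
  qed (use that bdry in \<open>auto simp: par_bdry_def\<close>)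
  have initial: "0 \<le> u (x, 0)" if "x \<in> closure \<Omega>" for x
  proof (cases "x \<in> \<Omega>")
    case True
    then show ?thesis using bdry by (simp add: par_bdry_def)
  next
    case False
    then show ?thesis using that lateral[of x 0] \<open>0 < T\<close> \<open>open \<Omega>\<close>
      by (simp add: frontier_def interior_open)
  qed

  obtain M where M: "AE z in lebesgue. z \<in> closure (par_cyl \<Omega> T) \<longrightarrow> \<bar>u z\<bar> \<le> M"
    using assms(13) by (auto simp: Linfty_def)
  let ?S = "\<Omega> \<times> {0<..<T}"
  have clS: "closure ?S = closure \<Omega> \<times> {0..T}"
    using \<open>0 < T\<close> by (simp add: closure_Times)
  have S_sub: "?S \<subseteq> closure \<Omega> \<times> {0..T}" using closure_subset[of \<Omega>] by auto
  have bound_S: "\<bar>u z\<bar> \<le> M" if "z \<in> ?S" for z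
  proof (rule continuous_essentially_bounded_on_open[OF _ _ _ that])
    show "open ?S" using \<open>open \<Omega>\<close> by (simp add: open_Times)
    show "continuous_on ?S u" using cont S_sub by (rule continuous_on_subset)
    show "AE z in lebesgue. z \<in> ?S \<longrightarrow> \<bar>u z\<bar> \<le> M"
      using M by eventually_elim (use S_sub cl in blast)
  qed
  have bound: "\<bar>u z\<bar> \<le> M" if "z \<in> closure \<Omega> \<times> {0..T}" for z
    by (rule continuous_le_on_closure[of ?S "\<lambda>z. \<bar>u z\<bar>"])
       (use that bound_S clS cont in \<open>auto intro!: continuous_intros\<close>)

  define I where "I = (\<integral>z. \<phi> z \<partial>lebesgue) + (\<integral>z. \<phi> z * (norm z)\<^sup>2 \<partial>lebesgue)"
  define K where "K = 2 * real CARD('n) * A + 2 * B + C + 2 * D * I + 1"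
  have "0 \<le> I" unfolding I_def using assms(9) by simp
  then have "0 \<le> K" unfolding K_def using assms(14-17) by simp
  have \<psi>: "integrable lebesgue (\<lambda>z. \<phi> z * (norm z)\<^sup>2)" 
  proof -
    have "\<psi> = (\<lambda>z. \<phi> z * (norm z)\<^sup>2)" using assms(10) by blast
    then show ?thesis using assms(24) by simp
  qed

  have barrier: "0 < u z + \<epsilon> * exp (K * snd z) * (1 + (norm (fst z))\<^sup>2)"
    if "0 < \<epsilon>" "z \<in> closure \<Omega> \<times> {0..T}" for \<epsilon> z
  proof (rule ccontr)
    define v where "v = (\<lambda>z. u z + \<epsilon> * exp (K * snd z) * (1 + (norm (fst z))\<^sup>2))"
    assume "\<not> 0 < u z + \<epsilon> * exp (K * snd z) * (1 + (norm (fst z))\<^sup>2)"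
    then have vz: "v z \<le> 0" by (simp add: v_def)
    have term_pos: "0 < \<epsilon> * exp (K * s) * (1 + (norm y)\<^sup>2)" for s and y :: "real^'n"
      using \<open>0 < \<epsilon>\<close> by (simp add: add_pos_nonneg)
    have v_cont: "continuous_on (closure \<Omega> \<times> {0..T}) v"
      unfolding v_def by (intro continuous_intros cont)
    \<comment> \<open>where \<open>v \<le> 0\<close> the barrier is at most \<open>M\<close>, which bounds the position\<close>
    have "norm y \<le> 1 + M / \<epsilon>" if "(y, s) \<in> closure \<Omega> \<times> {0..T}" "v (y, s) \<le> 0" for y s
    proof -
      have "\<epsilon> * (norm y)\<^sup>2 \<le> \<epsilon> * exp (K * s) * (1 + (norm y)\<^sup>2)"
      proof -
        have "1 \<le> exp (K * s)" using that \<open>0 \<le> K\<close> by simp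
        then have "1 * (norm y)\<^sup>2 \<le> exp (K * s) * (1 + (norm y)\<^sup>2)" by (intro mult_mono) auto
        then show ?thesis using \<open>0 < \<epsilon>\<close> by (simp add: mult.assoc)
      qed
      also have "\<dots> \<le> M" using bound[OF that(1)] that(2) by (simp add: v_def)
      finally have "(norm y)\<^sup>2 \<le> M / \<epsilon>" using \<open>0 < \<epsilon>\<close> by (simp add: field_simps)
      moreover have "norm y \<le> 1 + (norm y)\<^sup>2"
      proof -
        have "2 * norm y \<le> 1 + (norm y)\<^sup>2" using sum_squares_bound[of "norm y" 1] by simp
        then show ?thesis using norm_ge_zero[of y] by linarith
      qed
      ultimately show ?thesis by linarith
    qed
    then have "{z \<in> closure \<Omega> \<times> {0..T}. v z \<le> 0} \<subseteq> cball 0 (1 + M / \<epsilon>) \<times> {0..T}"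
      by auto
    then have bdd: "bounded {z \<in> closure \<Omega> \<times> {0..T}. v z \<le> 0}"
      by (rule bounded_subset[rotated]) (intro bounded_Times bounded_cball bounded_closed_interval)
    have "0 < v (y, 0)" if "y \<in> closure \<Omega>" for y
      unfolding v_def using initial[OF that] term_pos[of 0 y] by simp
    from first_touching_time[OF v_cont bdd this that(2) vz]
    obtain x t where x: "x \<in> closure \<Omega>" and t: "0 < t" "t \<le> T" and zero: "v (x, t) = 0"
      and nonneg: "\<And>y. y \<in> closure \<Omega> \<Longrightarrow> 0 \<le> v (y, t)"
      and past: "\<And>s. 0 \<le> s \<Longrightarrow> s < t \<Longrightarrow> 0 < v (x, s)"
      by blast
    have "x \<notin> frontier \<Omega>"
      using lateral[of x t] t term_pos[of t x] zero by (auto simp: v_def)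
    then have "x \<in> \<Omega>" using x \<open>open \<Omega>\<close> by (simp add: frontier_def interior_open)
    then have cyl: "(x, t) \<in> par_cyl \<Omega> T" using t by (simp add: par_cyl_def)
    have d: "0 \<le> d (x, t)" "d (x, t) \<le> D" using assms(23)[OF cyl] by auto
    have "0 < par_op \<Omega> T a b c d \<phi> u (x, t)"
    proof (rule par_op_pos_at_touching_point[where A = A and B = B and C = C and D = D
              and K = K and \<epsilon> = \<epsilon>])
      show "0 \<le> (\<Sum>i\<in>UNIV. \<Sum>j\<in>UNIV. a i j (x, t) * \<eta> $ i * \<eta> $ j)" for \<eta> :: "real^'n"
        by (rule order_trans[OF _ assms(7)[OF cyl]]) (use assms(6) in simp)
      show "2 * real CARD('n) * A + 2 * B + C
              + 2 * D * ((\<integral>z. \<phi> z \<partial>lebesgue) + (\<integral>z. \<phi> z * (norm z)\<^sup>2 \<partial>lebesgue)) < K"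
        by (simp add: K_def I_def)
      show "0 \<le> u (y, t) + \<epsilon> * exp (K * t) * (1 + (norm y)\<^sup>2)" if "y \<in> \<Omega>" for y
        using nonneg[of y] that closure_subset[of \<Omega>] by (auto simp: v_def)
      show "0 \<le> u (x, s) + \<epsilon> * exp (K * s) * (1 + (norm x)\<^sup>2)" if "0 < s" "s < t" for s
        using past[of s] that by (simp add: v_def)
      show "u (x, t) + \<epsilon> * exp (K * t) * (1 + (norm x)\<^sup>2) = 0"
        using zero by (simp add: v_def)
    qed (rule \<open>open \<Omega>\<close> \<open>x \<in> \<Omega>\<close> t assms(8,9) \<psi> assms(12) assms(20-22)[OF cyl] d \<open>0 < \<epsilon>\<close>)+
    then show False using P_le[OF cyl] by simp
  qed

  show ?thesis
    unfolding cl
  proof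
    fix z assume z: "z \<in> closure \<Omega> \<times> {0..T}"
    define h where "h = exp (K * snd z) * (1 + (norm (fst z))\<^sup>2)"
    have "0 < h" unfolding h_def by (simp add: add_pos_nonneg)
    show "0 \<le> u z"
    proof (rule field_le_epsilon)
      fix e :: real assume "0 < e"
      with \<open>0 < h\<close> barrier[of "e / h", OF _ z] show "0 \<le> u z + e"
        by (simp add: h_def[symmetric] mult.assoc)
    qed
  qed
qed

end
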